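(* Let $A$ be a vector space, $w_1,w_2\in\mathrm{Hom}(A\otimes A,A)$ and $\delta_1,\delta_2\in\mathrm{Hom}(A,A)$. Then $(A,w_1,w_2,\delta_1,\delta_2)$ is a compatible AssDer pair if and only if $\big((w_1,\delta_1),(w_2,\delta_2)\big)$ is a compatible pair of Maurer-Cartan elements of the bidifferential graded Lie algebra $(C^{\ast}_{\mathrm{AssDer}}(A,A),[\![\cdot,\cdot]\!],0,0)$ with both differentials equal to zero.
   Context: All vector spaces are over a field $\mathbb{K}$ of characteristic $0$. An AssDer pair $(A,\mu,\delta)$ is an associative algebra $(A,\mu)$ with a linear map $\delta:A\to A$ such that $\delta\mu(x,y)=\mu(\delta x,y)+\mu(x,\delta y)$. A compatible AssDer pair $(A,\mu_1,\mu_2,\delta_1,\delta_2)$ consists of two AssDer pairs $(A,\mu_1,\delta_1)$, $(A,\mu_2,\delta_2)$ such that for all $x,y,z\in A$: $\mu_2(\mu_1(x,y),z)+\mu_1(\mu_2(x,y),z)=\mu_1(x,\mu_2(y,z))+\mu_2(x,\mu_1(y,z))$ and $\delta_1(\mu_2(x,y))+\delta_2(\mu_1(x,y))=\mu_2(\delta_1x,y)+\mu_2(x,\delta_1y)+\mu_1(\delta_2x,y)+\mu_1(x,\delta_2y)$. Let $C^n(A,A)=\mathrm{Hom}(A^{\otimes n},A)$. For $f\in C^{p+1}(A,A)$, $g\in C^{q+1}(A,A)$ the Gerstenhaber bracket is $[f,g]_G=f\circ g-(-1)^{pq}g\circ f$, where $(f\circ g)(x_1,\ldots,x_{p+q+1})=\sum_{i=1}^{p+1}(-1)^{(i-1)q}f(x_1,\ldots,x_{i-1},g(x_i,\ldots,x_{i+q}),\ldots,x_{p+q+1})$.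 Set $C^0_{\mathrm{AssDer}}(A,A)=0$, $C^1_{\mathrm{AssDer}}(A,A)=\mathrm{Hom}(A,A)$ (an element $f$ is regarded as the pair $(f,0)$), and $C^n_{\mathrm{AssDer}}(A,A)=C^n(A,A)\oplus C^{n-1}(A,A)$ for $n\ge2$. The graded space $C^{\ast}_{\mathrm{AssDer}}(A,A)=\bigoplus_{n\ge0}C^n_{\mathrm{AssDer}}(A,A)$, with elements of $C^n_{\mathrm{AssDer}}$ in degree $n-1$, is a graded Lie algebra under $[\![(f_m,f_{m-1}),(g_n,g_{n-1})]\!]=\big([f_m,g_n]_G,(-1)^{m+1}[f_m,g_{n-1}]_G+[f_{m-1},g_n]_G\big)\in C^{m+n-1}_{\mathrm{AssDer}}(A,A)$. A bidifferential graded Lie algebra is a graded Lie algebra with two differentials $d_1,d_2$, each making it a differential graded Lie algebra, such that $d_1d_2+d_2d_1=0$. An element $P$ of degree $1$ of a differential graded Lie algebra is Maurer-Cartan if $dP+\frac12[P,P]=0$. When both differentials are zero, a compatible pair of Maurer-Cartan elements is a pair $(P_1,P_2)$ of degree-$1$ elements such that $P_1$ and $P_2$ are each Maurer-Cartan (i.e. $[\![P_1,P_1]\!]=[\![P_2,P_2]\!]=0$) and $[\![P_1,P_2]\!]=0$. *)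

theory Defs
  imports Complex_Main "HOL-Library.Function_Algebras" "HOL-Library.Product_Plus"
begin

section \<open>AssDer pairs\<close>

text \<open>A vector space over a field of characteristic 0 is a type \<open>'a\<close> with a scalar
  multiplication \<open>s\<close> such that \<open>vector_space s\<close> holds. Elements of \<open>Hom(A \<otimes> A, A)\<close> are
  curried bilinear maps.\<close>

definition bilinear_op :: "('k::field_char_0 \<Rightarrow> 'a::ab_group_add \<Rightarrow> 'a) \<Rightarrow> ('a \<Rightarrow> 'a \<Rightarrow> 'a) \<Rightarrow> bool"
  where "bilinear_op s w \<longleftrightarrow>
    (\<forall>x. Vector_Spaces.linear s s (\<lambda>y. w x y)) \<and> (\<forall>y. Vector_Spaces.linear s s (\<lambda>x. w x y))"

definition assder_pair ::
  "('k::field_char_0 \<Rightarrow> 'a::ab_group_add \<Rightarrow> 'a) \<Rightarrow> ('a \<Rightarrow> 'a \<Rightarrow> 'a) \<Rightarrow> ('a \<Rightarrow> 'a) \<Rightarrow> bool"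
  where "assder_pair s \<mu> \<delta> \<longleftrightarrow>
    vector_space s \<and> bilinear_op s \<mu> \<and> Vector_Spaces.linear s s \<delta> \<and>
    (\<forall>x y z. \<mu> (\<mu> x y) z = \<mu> x (\<mu> y z)) \<and>
    (\<forall>x y. \<delta> (\<mu> x y) = \<mu> (\<delta> x) y + \<mu> x (\<delta> y))"

definition compatible_assder_pair ::
  "('k::field_char_0 \<Rightarrow> 'a::ab_group_add \<Rightarrow> 'a) \<Rightarrow>
    ('a \<Rightarrow> 'a \<Rightarrow> 'a) \<Rightarrow> ('a \<Rightarrow> 'a \<Rightarrow> 'a) \<Rightarrow> ('a \<Rightarrow> 'a) \<Rightarrow> ('a \<Rightarrow> 'a) \<Rightarrow> bool"
  where "compatible_assder_pair s \<mu>\<^sub>1 \<mu>\<^sub>2 \<delta>\<^sub>1 \<delta>\<^sub>2 \<longleftrightarrow>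
    assder_pair s \<mu>\<^sub>1 \<delta>\<^sub>1 \<and> assder_pair s \<mu>\<^sub>2 \<delta>\<^sub>2 \<and>
    (\<forall>x y z. \<mu>\<^sub>2 (\<mu>\<^sub>1 x y) z + \<mu>\<^sub>1 (\<mu>\<^sub>2 x y) z = \<mu>\<^sub>1 x (\<mu>\<^sub>2 y z) + \<mu>\<^sub>2 x (\<mu>\<^sub>1 y z)) \<and>
    (\<forall>x y. \<delta>\<^sub>1 (\<mu>\<^sub>2 x y) + \<delta>\<^sub>2 (\<mu>\<^sub>1 x y) =
       \<mu>\<^sub>2 (\<delta>\<^sub>1 x) y + \<mu>\<^sub>2 x (\<delta>\<^sub>1 y) + \<mu>\<^sub>1 (\<delta>\<^sub>2 x) y + \<mu>\<^sub>1 x (\<delta>\<^sub>2 y))"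


section \<open>Bidifferential graded Lie algebras and Maurer-Cartan elements\<close>

text \<open>A graded vector space \<open>\<Oplus>\<^sub>i L i\<close> is given by its homogeneous components, which are subspaces
  of a common type. The bracket and the differentials carry the degrees of their arguments and
  matter only on the corresponding components.\<close>

locale graded_lie_algebra = vector_space s
  for s :: "'k::field_char_0 \<Rightarrow> 'v::ab_group_add \<Rightarrow> 'v" +
  fixes L :: "int \<Rightarrow> 'v set"
    and br :: "int \<Rightarrow> int \<Rightarrow> 'v \<Rightarrow> 'v \<Rightarrow> 'v"
  assumes subspace_L: "subspace (L i)"
    and br_closed: "x \<in> L i \<Longrightarrow> y \<in> L j \<Longrightarrow> br i j x y \<in> L (i + j)"
    and br_add_left: "x \<in> L i \<Longrightarrow> x' \<in> L i \<Longrightarrow> y \<in> L j \<Longrightarrow> br i j (x + x') y = br i j x y + br i j x' y"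
    and br_add_right: "x \<in> L i \<Longrightarrow> y \<in> L j \<Longrightarrow> y' \<in> L j \<Longrightarrow> br i j x (y + y') = br i j x y + br i j x y'"
    and br_scale_left: "x \<in> L i \<Longrightarrow> y \<in> L j \<Longrightarrow> br i j (s c x) y = s c (br i j x y)"
    and br_scale_right: "x \<in> L i \<Longrightarrow> y \<in> L j \<Longrightarrow> br i j x (s c y) = s c (br i j x y)"
    and br_skew: "x \<in> L i \<Longrightarrow> y \<in> L j \<Longrightarrow> br i j x y = - s ((- 1) powi (i * j)) (br j i y x)"
    and br_jacobi: "x \<in> L i \<Longrightarrow> y \<in> L j \<Longrightarrow> z \<in> L k \<Longrightarrow>
      br i (j + k) x (br j k y z) =
        br (i + j) k (br i j x y) z + s ((- 1) powi (i * j)) (br j (i + k) y (br i k x z))"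

locale diff_graded_lie_algebra = graded_lie_algebra s L br
  for s :: "'k::field_char_0 \<Rightarrow> 'v::ab_group_add \<Rightarrow> 'v" and L br +
  fixes d :: "int \<Rightarrow> 'v \<Rightarrow> 'v"
  assumes d_closed: "x \<in> L i \<Longrightarrow> d i x \<in> L (i + 1)"
    and d_add: "x \<in> L i \<Longrightarrow> x' \<in> L i \<Longrightarrow> d i (x + x') = d i x + d i x'"
    and d_scale: "x \<in> L i \<Longrightarrow> d i (s c x) = s c (d i x)"
    and d_d: "x \<in> L i \<Longrightarrow> d (i + 1) (d i x) = 0"
    and d_br: "x \<in> L i \<Longrightarrow> y \<in> L j \<Longrightarrow>
      d (i + j) (br i j x y) = br (i + 1) j (d i x) y + s ((- 1) powi i) (br i (j + 1) x (d j y))"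

locale bidiff_graded_lie_algebra =
  diff_graded_lie_algebra s L br d\<^sub>1 + D2: diff_graded_lie_algebra s L br d\<^sub>2
  for s :: "'k::field_char_0 \<Rightarrow> 'v::ab_group_add \<Rightarrow> 'v" and L br d\<^sub>1 d\<^sub>2 +
  assumes d_anticomm: "x \<in> L i \<Longrightarrow> d\<^sub>1 (i + 1) (d\<^sub>2 i x) + d\<^sub>2 (i + 1) (d\<^sub>1 i x) = 0"

definition maurer_cartan ::
  "('k::field_char_0 \<Rightarrow> 'v::ab_group_add \<Rightarrow> 'v) \<Rightarrow> (int \<Rightarrow> 'v set) \<Rightarrow>
    (int \<Rightarrow> int \<Rightarrow> 'v \<Rightarrow> 'v \<Rightarrow> 'v) \<Rightarrow> (int \<Rightarrow> 'v \<Rightarrow> 'v) \<Rightarrow> 'v \<Rightarrow> bool"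
  where "maurer_cartan s L br d P \<longleftrightarrow>
    diff_graded_lie_algebra s L br d \<and> P \<in> L 1 \<and> d 1 P + s (1 / 2) (br 1 1 P P) = 0"

text \<open>The mixed condition is the usual one for arbitrary differentials; when both are zero it
  says that \<open>br 1 1 P\<^sub>1 P\<^sub>2 = 0\<close>.\<close>

definition compatible_maurer_cartan ::
  "('k::field_char_0 \<Rightarrow> 'v::ab_group_add \<Rightarrow> 'v) \<Rightarrow> (int \<Rightarrow> 'v set) \<Rightarrow>
    (int \<Rightarrow> int \<Rightarrow> 'v \<Rightarrow> 'v \<Rightarrow> 'v) \<Rightarrow> (int \<Rightarrow> 'v \<Rightarrow> 'v) \<Rightarrow> (int \<Rightarrow> 'v \<Rightarrow> 'v) \<Rightarrow> 'v \<Rightarrow> 'v \<Rightarrow> bool"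
  where "compatible_maurer_cartan s L br d\<^sub>1 d\<^sub>2 P\<^sub>1 P\<^sub>2 \<longleftrightarrow>
    bidiff_graded_lie_algebra s L br d\<^sub>1 d\<^sub>2 \<and>
    maurer_cartan s L br d\<^sub>1 P\<^sub>1 \<and> maurer_cartan s L br d\<^sub>2 P\<^sub>2 \<and>
    d\<^sub>1 1 P\<^sub>2 + d\<^sub>2 1 P\<^sub>1 + br 1 1 P\<^sub>1 P\<^sub>2 = 0"


section \<open>The graded Lie algebra of an AssDer pair\<close>

text \<open>An element of \<open>C\<^sup>n(A, A) = Hom(A\<^sup>\<otimes>\<^sup>n, A)\<close> is a multilinear map on lists of length \<open>n\<close>,
  extended by zero to the other lists.\<close>

definition cochains :: "('k::field_char_0 \<Rightarrow> 'a::ab_group_add \<Rightarrow> 'a) \<Rightarrow> nat \<Rightarrow> ('a list \<Rightarrow> 'a) set"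
  where "cochains s n = {f.
    (\<forall>xs i. length xs = n \<longrightarrow> i < n \<longrightarrow> Vector_Spaces.linear s s (\<lambda>x. f (xs[i := x]))) \<and>
    (\<forall>xs. length xs \<noteq> n \<longrightarrow> f xs = 0)}"

definition cochain1 :: "('a::zero \<Rightarrow> 'a) \<Rightarrow> 'a list \<Rightarrow> 'a"
  where "cochain1 \<delta> xs = (if length xs = 1 then \<delta> (xs ! 0) else 0)"

definition cochain2 :: "('a::zero \<Rightarrow> 'a \<Rightarrow> 'a) \<Rightarrow> 'a list \<Rightarrow> 'a"
  where "cochain2 w xs = (if length xs = 2 then w (xs ! 0) (xs ! 1) else 0)"

text \<open>Here \<open>m = p + 1\<close> and \<open>n = q + 1\<close> are the arities of \<open>f\<close> and \<open>g\<close>, and \<open>i\<close> counts from 0.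
  Truncated subtraction is harmless: a cochain of arity 0 enters the bracket below only if it
  is zero.\<close>

definition gcirc :: "('k::field_char_0 \<Rightarrow> 'a::ab_group_add \<Rightarrow> 'a) \<Rightarrow> nat \<Rightarrow> nat \<Rightarrow>
    ('a list \<Rightarrow> 'a) \<Rightarrow> ('a list \<Rightarrow> 'a) \<Rightarrow> 'a list \<Rightarrow> 'a"
  where "gcirc s m n f g xs =
    (if length xs = m + n - 1
     then \<Sum>i<m. s ((- 1) ^ (i * (n - 1))) (f (take i xs @ g (take n (drop i xs)) # drop (i + n) xs))
     else 0)"

definition gerstenhaber :: "('k::field_char_0 \<Rightarrow> 'a::ab_group_add \<Rightarrow> 'a) \<Rightarrow> nat \<Rightarrow> nat \<Rightarrow>
    ('a list \<Rightarrow> 'a) \<Rightarrow> ('a list \<Rightarrow> 'a) \<Rightarrow> 'a list \<Rightarrow> 'a"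
  where "gerstenhaber s m n f g xs =
    gcirc s m n f g xs - s ((- 1) ^ ((m - 1) * (n - 1))) (gcirc s n m g f xs)"

definition assder_cochains :: "('k::field_char_0 \<Rightarrow> 'a::ab_group_add \<Rightarrow> 'a) \<Rightarrow> nat \<Rightarrow>
    (('a list \<Rightarrow> 'a) \<times> ('a list \<Rightarrow> 'a)) set"
  where "assder_cochains s n =
    (if n = 0 then {(0, 0)} else if n = 1 then cochains s 1 \<times> {0}
     else cochains s n \<times> cochains s (n - 1))"

fun assder_bracket :: "('k::field_char_0 \<Rightarrow> 'a::ab_group_add \<Rightarrow> 'a) \<Rightarrow> nat \<Rightarrow> nat \<Rightarrow>
    ('a list \<Rightarrow> 'a) \<times> ('a list \<Rightarrow> 'a) \<Rightarrow> ('a list \<Rightarrow> 'a) \<times> ('a list \<Rightarrow> 'a) \<Rightarrow>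
    ('a list \<Rightarrow> 'a) \<times> ('a list \<Rightarrow> 'a)"
  where "assder_bracket s m n (f, f') (g, g') =
    (gerstenhaber s m n f g,
     \<lambda>xs. s ((- 1) ^ (m + 1)) (gerstenhaber s m (n - 1) f g' xs) + gerstenhaber s (m - 1) n f' g xs)"

fun cochain_pair_scale :: "('k \<Rightarrow> 'a \<Rightarrow> 'a) \<Rightarrow> 'k \<Rightarrow>
    ('a list \<Rightarrow> 'a) \<times> ('a list \<Rightarrow> 'a) \<Rightarrow> ('a list \<Rightarrow> 'a) \<times> ('a list \<Rightarrow> 'a)"
  where "cochain_pair_scale s c (f, f') = (\<lambda>xs. s c (f xs), \<lambda>xs. s c (f' xs))"

text \<open>Degree \<open>i\<close> is arity \<open>i + 1\<close>. For \<open>i < -1\<close> the arity truncates to 0, where the component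
  is zero, as it should be.\<close>

definition assder_component :: "('k::field_char_0 \<Rightarrow> 'a::ab_group_add \<Rightarrow> 'a) \<Rightarrow> int \<Rightarrow>
    (('a list \<Rightarrow> 'a) \<times> ('a list \<Rightarrow> 'a)) set"
  where "assder_component s i = assder_cochains s (nat (i + 1))"

definition assder_degree_bracket :: "('k::field_char_0 \<Rightarrow> 'a::ab_group_add \<Rightarrow> 'a) \<Rightarrow> int \<Rightarrow> int \<Rightarrow>
    ('a list \<Rightarrow> 'a) \<times> ('a list \<Rightarrow> 'a) \<Rightarrow> ('a list \<Rightarrow> 'a) \<times> ('a list \<Rightarrow> 'a) \<Rightarrow>
    ('a list \<Rightarrow> 'a) \<times> ('a list \<Rightarrow> 'a)"
  where "assder_degree_bracket s i j = assder_bracket s (nat (i + 1)) (nat (j + 1))"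

end

theory Submission
  imports Defs
begin

text \<open>That a compatible pair of Maurer-Cartan elements is the same as a compatible AssDer pair is
  read off from the brackets of 2-cochains with 1- and 2-cochains. The real work is that the
  ambient object is a graded Lie algebra. The Gerstenhaber bracket is the commutator of the graded
  pre-Lie product of insertion: the associator of \<open>f\<close>, \<open>g\<close>, \<open>h\<close> consists of the insertions of \<open>g\<close>
  and \<open>h\<close> into different slots of \<open>f\<close>, and this is graded symmetric in \<open>g\<close> and \<open>h\<close>. The AssDer
  complex is then the tensor product of the Gerstenhaber algebra with the exterior algebra on one
  generator \<open>\<epsilon>\<close> of degree 1.\<close>

section \<open>Graded pre-Lie algebras and their commutators\<close>

lemma power_int_minus_one_eq: "(- 1 :: 'k::field) powi n = (if even n then 1 else - 1)"
  by (simp add: power_int_minus_left)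

locale graded_pre_lie_algebra = vector_space s
  for s :: "'k::field_char_0 \<Rightarrow> 'v::ab_group_add \<Rightarrow> 'v" +
  fixes L :: "int \<Rightarrow> 'v set"
    and circ :: "int \<Rightarrow> int \<Rightarrow> 'v \<Rightarrow> 'v \<Rightarrow> 'v"
  assumes subspace_L: "subspace (L i)"
    and circ_closed: "x \<in> L i \<Longrightarrow> y \<in> L j \<Longrightarrow> circ i j x y \<in> L (i + j)"
    and circ_add_left:
      "x \<in> L i \<Longrightarrow> x' \<in> L i \<Longrightarrow> y \<in> L j \<Longrightarrow> circ i j (x + x') y = circ i j x y + circ i j x' y"
    and circ_add_right:
      "x \<in> L i \<Longrightarrow> y \<in> L j \<Longrightarrow> y' \<in> L j \<Longrightarrow> circ i j x (y + y') = circ i j x y + circ i j x y'"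
    and circ_scale_left: "x \<in> L i \<Longrightarrow> y \<in> L j \<Longrightarrow> circ i j (s c x) y = s c (circ i j x y)"
    and circ_scale_right: "x \<in> L i \<Longrightarrow> y \<in> L j \<Longrightarrow> circ i j x (s c y) = s c (circ i j x y)"
    and circ_associator: "x \<in> L i \<Longrightarrow> y \<in> L j \<Longrightarrow> z \<in> L k \<Longrightarrow>
      circ (i + j) k (circ i j x y) z - circ i (j + k) x (circ j k y z) =
        s ((- 1) powi (j * k)) (circ (i + k) j (circ i k x z) y - circ i (k + j) x (circ k j z y))"
begin

lemma circ_diff_left:
  assumes "x \<in> L i" "x' \<in> L i" "y \<in> L j"
  shows "circ i j (x - x') y = circ i j x y - circ i j x' y"
  using circ_add_left[of "x - x'" i x' y j] assms subspace_diff[OF subspace_L] by auto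

lemma circ_diff_right:
  assumes "x \<in> L i" "y \<in> L j" "y' \<in> L j"
  shows "circ i j x (y - y') = circ i j x y - circ i j x y'"
  using circ_add_right[of x i "y - y'" j y'] assms subspace_diff[OF subspace_L] by auto

text \<open>The twelve nested products in the Jacobi identity group into six associators, one for
  each order of the three arguments. The axiom \<open>circ_associator\<close> cancels them in pairs
  that share the first argument.\<close>

theorem graded_lie_algebra_commutator:
  "graded_lie_algebra s L (\<lambda>i j x y. circ i j x y - s ((- 1) powi (i * j)) (circ j i y x))"
    (is "graded_lie_algebra s L ?br")
proof
  fix i j k x x' y y' z c
  show "subspace (L i)" by (rule subspace_L)
  show "?br i j x y \<in> L (i + j)" if "x \<in> L i" "y \<in> L j"
    using that circ_closed[of x i y j] circ_closed[of y j x i]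
    by (auto simp: add.commute[of j i] intro!: subspace_diff[OF subspace_L] subspace_scale[OF subspace_L])
  show "?br i j (x + x') y = ?br i j x y + ?br i j x' y" if "x \<in> L i" "x' \<in> L i" "y \<in> L j"
    using that by (simp add: circ_add_left circ_add_right algebra_simps)
  show "?br i j x (y + y') = ?br i j x y + ?br i j x y'" if "x \<in> L i" "y \<in> L j" "y' \<in> L j"
    using that by (simp add: circ_add_left circ_add_right algebra_simps)
  show "?br i j (s c x) y = s c (?br i j x y)" if "x \<in> L i" "y \<in> L j"
    using that by (simp add: circ_scale_left circ_scale_right algebra_simps)
  show "?br i j x (s c y) = s c (?br i j x y)" if "x \<in> L i" "y \<in> L j"
    using that by (simp add: circ_scale_left circ_scale_right algebra_simps)
  show "?br i j x y = - s ((- 1) powi (i * j)) (?br j i y x)"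
    by (simp add: power_int_minus_one_eq algebra_simps)
  show "?br i (j + k) x (?br j k y z) =
      ?br (i + j) k (?br i j x y) z + s ((- 1) powi (i * j)) (?br j (i + k) y (?br i k x z))"
    if x: "x \<in> L i" and y: "y \<in> L j" and z: "z \<in> L k"
  proof -
    have mem: "circ i j x y \<in> L (i + j)" "circ j i y x \<in> L (i + j)"
        "circ i k x z \<in> L (i + k)" "circ k i z x \<in> L (i + k)"
        "circ j k y z \<in> L (j + k)" "circ k j z y \<in> L (j + k)"
      using circ_closed x y z by (metis add.commute)+
    note sc = mem[THEN subspace_scale[OF subspace_L]]
    note lin = circ_add_left circ_add_right circ_diff_left circ_diff_right circ_scale_left circ_scale_right
    \<comment> \<open>One associator identity for each choice of first argument. Solved for (xy)z,
      (yx)z and (zy)x, they rewrite these into (xz)y, (yz)x and (zx)y, so rewriting does not loop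
      and the rest cancels once the parities fix the signs.\<close>
    have A: "circ (i + j) k (circ i j x y) z = circ i (j + k) x (circ j k y z) +
        s ((- 1) powi (j * k)) (circ (i + k) j (circ i k x z) y - circ i (j + k) x (circ k j z y))"
      using circ_associator[OF x y z] by (simp add: algebra_simps)
    have B: "circ (i + j) k (circ j i y x) z = circ j (i + k) y (circ i k x z) +
        s ((- 1) powi (i * k)) (circ (j + k) i (circ j k y z) x - circ j (i + k) y (circ k i z x))"
      using circ_associator[OF y x z] by (simp add: algebra_simps)
    have C: "circ (j + k) i (circ k j z y) x = circ k (i + j) z (circ j i y x) +
        s ((- 1) powi (i * j)) (circ (i + k) j (circ k i z x) y - circ k (i + j) z (circ i j x y))"
      using circ_associator[OF z y x] by (simp add: algebra_simps)
    show ?thesis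
      using x y z mem sc
      by (cases "even i"; cases "even j"; cases "even k")
        (simp_all add: lin A B C power_int_minus_one_eq algebra_simps)
  qed
qed

end

section \<open>Graded Lie algebras extended by an odd generator\<close>

lemma (in graded_lie_algebra) br_diff_left:
  assumes "x \<in> L i" "x' \<in> L i" "y \<in> L j"
  shows "br i j (x - x') y = br i j x y - br i j x' y"
  using br_add_left[of "x - x'" i x' y j] assms subspace_diff[OF subspace_L] by auto

lemma (in graded_lie_algebra) br_diff_right:
  assumes "x \<in> L i" "y \<in> L j" "y' \<in> L j"
  shows "br i j x (y - y') = br i j x y - br i j x y'"
  using br_add_right[of x i "y - y'" j y'] assms subspace_diff[OF subspace_L] by auto

text \<open>The axioms constrain a bracket only on the components. This matters below because a
  bracket indexed by truncated arities matches the one indexed by integer degrees only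
  there.\<close>

lemma graded_lie_algebra_cong:
  assumes "graded_lie_algebra s L br"
    and eq: "\<And>i j x y. x \<in> L i \<Longrightarrow> y \<in> L j \<Longrightarrow> br' i j x y = br i j x y"
  shows "graded_lie_algebra s L br'"
proof -
  interpret graded_lie_algebra s L br by fact
  note closed = br_closed subspace_add[OF subspace_L] subspace_scale[OF subspace_L]
  show ?thesis
  proof
    fix i j x y assume "x \<in> L i" "y \<in> L j"
    then show "br' i j x y = - s ((- 1) powi (i * j)) (br' j i y x)"
      using br_skew[of x i y j] by (simp add: eq)
  next
    fix i j k x y z assume "x \<in> L i" "y \<in> L j" "z \<in> L k"
    then show "br' i (j + k) x (br' j k y z) =
        br' (i + j) k (br' i j x y) z + s ((- 1) powi (i * j)) (br' j (i + k) y (br' i k x z))"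
      by (simp only: eq br_closed br_jacobi[of x i y j z k])
  qed (simp_all add: eq closed subspace_L br_add_left br_add_right br_scale_left br_scale_right)
qed

text \<open>The pair \<open>(x, x')\<close> stands for \<open>x + \<epsilon> x'\<close>, where \<open>\<epsilon>\<close> has degree 1; moving \<open>\<epsilon>\<close> past \<open>x\<close>
  produces the sign.\<close>

theorem graded_lie_algebra_pair:
  fixes s :: "'k::field_char_0 \<Rightarrow> 'v::ab_group_add \<Rightarrow> 'v"
  assumes "graded_lie_algebra s L br"
  shows "graded_lie_algebra (\<lambda>c (x, x'). (s c x, s c x')) (\<lambda>i. L i \<times> L (i - 1))
    (\<lambda>i j (x, x') (y, y'). (br i j x y, s ((- 1) powi i) (br i (j - 1) x y') + br (i - 1) j x' y))"
    (is "graded_lie_algebra ?s ?L ?br")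
proof -
  interpret graded_lie_algebra s L br by fact
  interpret P: vector_space ?s
    by unfold_locales (auto simp: algebra_simps)
  have closed1: "br i (j - 1) x y \<in> L (i + j - 1)" if "x \<in> L i" "y \<in> L (j - 1)" for i j x y
    using br_closed[OF that] by (simp add: algebra_simps)
  have closed2: "br (i - 1) j x y \<in> L (i + j - 1)" if "x \<in> L (i - 1)" "y \<in> L j" for i j x y
    using br_closed[OF that] by (simp add: algebra_simps)
  note closed = br_closed closed1 closed2 subspace_add[OF subspace_L] subspace_scale[OF subspace_L]
  show ?thesis
  proof
    fix i j k :: int and x x' y y' z :: "'v \<times> 'v" and c :: 'k
    show "P.subspace (?L i)"
      unfolding P.subspace_def
      by (auto simp: zero_prod_def subspace_L subspace_0 subspace_add subspace_scale)
    show "?br i j x y \<in> ?L (i + j)" if "x \<in> ?L i" "y \<in> ?L j"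
      using that by (auto simp: closed)
    show "?br i j (x + x') y = ?br i j x y + ?br i j x' y"
      if "x \<in> ?L i" "x' \<in> ?L i" "y \<in> ?L j"
      using that by (auto simp: br_add_left algebra_simps)
    show "?br i j x (y + y') = ?br i j x y + ?br i j x y'"
      if "x \<in> ?L i" "y \<in> ?L j" "y' \<in> ?L j"
      using that by (auto simp: br_add_right algebra_simps)
    show "?br i j (?s c x) y = ?s c (?br i j x y)" if "x \<in> ?L i" "y \<in> ?L j"
      using that by (auto simp: br_scale_left algebra_simps)
    show "?br i j x (?s c y) = ?s c (?br i j x y)" if "x \<in> ?L i" "y \<in> ?L j"
      using that by (auto simp: br_scale_right algebra_simps)
    show "?br i j x y = - ?s ((- 1) powi (i * j)) (?br j i y x)" if "x \<in> ?L i" "y \<in> ?L j"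
    proof -
      obtain u u' v v' where [simp]: "x = (u, u')" "y = (v, v')"
        by (metis surj_pair)
      have mem: "u \<in> L i" "u' \<in> L (i - 1)" "v \<in> L j" "v' \<in> L (j - 1)"
        using that by auto
      show ?thesis
        using br_skew[OF mem(1,3)] br_skew[OF mem(1,4)] br_skew[OF mem(2,3)]
        by (cases "even i"; cases "even j") (simp_all add: power_int_minus_one_eq algebra_simps)
    qed
    show "?br i (j + k) x (?br j k y z) =
        ?br (i + j) k (?br i j x y) z + ?s ((- 1) powi (i * j)) (?br j (i + k) y (?br i k x z))"
      if "x \<in> ?L i" "y \<in> ?L j" "z \<in> ?L k"
    proof -
      obtain u u' v v' w w' where [simp]: "x = (u, u')" "y = (v, v')" "z = (w, w')"
        by (metis surj_pair)
      have mem: "u \<in> L i" "u' \<in> L (i - 1)" "v \<in> L j" "v' \<in> L (j - 1)" "w \<in> L k" "w' \<in> L (k - 1)"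
        using that by auto
      note lin = br_add_left br_add_right br_diff_left br_diff_right br_scale_left br_scale_right
      \<comment> \<open>\<open>J\<close> is the part free of the odd generator; \<open>J1\<close>,
        \<open>J2\<close> and \<open>J3\<close> are the parts where it comes from the first, second
        and third argument. Products of two generators vanish, so no further identity
        arises.\<close>
      have J: "br i (j + k) u (br j k v w) =
          br (i + j) k (br i j u v) w + s ((- 1) powi (i * j)) (br j (i + k) v (br i k u w))"
        using br_jacobi[OF mem(1,3,5)] .
      have J1: "br (i - 1) (j + k) u' (br j k v w) =
          br (i + j - 1) k (br (i - 1) j u' v) w
          + s ((- 1) powi ((i - 1) * j)) (br j (i + k - 1) v (br (i - 1) k u' w))"
        using br_jacobi[OF mem(2,3,5)] by (simp add: algebra_simps)
      have J2: "br i (j + k - 1) u (br (j - 1) k v' w) =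
          br (i + j - 1) k (br i (j - 1) u v') w
          + s ((- 1) powi (i * (j - 1))) (br (j - 1) (i + k) v' (br i k u w))"
        using br_jacobi[OF mem(1,4,5)] by (simp add: algebra_simps)
      have J3: "br i (j + k - 1) u (br j (k - 1) v w') =
          br (i + j) (k - 1) (br i j u v) w'
          + s ((- 1) powi (i * j)) (br j (i + k - 1) v (br i (k - 1) u w'))"
        using br_jacobi[OF mem(1,3,6)] by (simp add: algebra_simps)
      show ?thesis
        using mem
        by (cases "even i"; cases "even j")
          (simp_all add: lin closed J J1 J2 J3 power_int_minus_one_eq algebra_simps)
    qed
  qed
qed

section \<open>Insertions into argument lists and sums over slots\<close>

text \<open>Separating the list surgery from the outer function turns statements about iterated
  insertions into equations between lists.\<close>

definition plug :: "nat \<Rightarrow> nat \<Rightarrow> ('a list \<Rightarrow> 'a) \<Rightarrow> 'a list \<Rightarrow> 'a list"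
  where "plug i n g xs = take i xs @ g (take n (drop i xs)) # drop (i + n) xs"

lemma gcirc_plug:
  "gcirc s m n f g xs = (if length xs = m + n - 1
     then \<Sum>i<m. s ((- 1) ^ (i * (n - 1))) (f (plug i n g xs)) else 0)"
  by (simp add: gcirc_def plug_def)

lemma length_plug: "i + n \<le> length xs \<Longrightarrow> length (plug i n g xs) = length xs + 1 - n"
  by (simp add: plug_def)

lemma plug_append: "length us = i \<Longrightarrow> length vs = n \<Longrightarrow> plug i n g (us @ vs @ ws) = us @ g vs # ws"
  by (simp add: plug_def)

lemma split_list_length:
  assumes "n \<le> length xs"
  obtains us vs where "xs = us @ vs" "length us = n" "length xs = n + length vs"
  using assms by (intro that[of "take n xs" "drop n xs"]) auto

lemma plug_list_update_before: "t < i \<Longrightarrow> i \<le> length xs \<Longrightarrow>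
    plug i n g (xs[t := x]) = (plug i n g xs)[t := x]"
  by (simp add: plug_def take_update_swap list_update_append)

lemma plug_list_update_inside: "i \<le> t \<Longrightarrow> t < i + n \<Longrightarrow>
    plug i n g (xs[t := x]) = take i xs @ g ((take n (drop i xs))[t - i := x]) # drop (i + n) xs"
  by (simp add: plug_def drop_update_swap take_update_swap list_update_beyond)

text \<open>The block of \<open>n\<close> entries shrinks to a single one, so every later position
  moves by \<open>1 - n\<close>.\<close>

lemma plug_list_update_after:
  assumes "i + n \<le> t" "i + n \<le> length xs"
  shows "plug i n g (xs[t := x]) = (plug i n g xs)[t + 1 - n := x]"
proof -
  obtain us ys where "xs = us @ ys" and us: "length us = i" "length xs = i + length ys"
    by (rule split_list_length[of i xs]) (use assms in linarith)
  moreover obtain vs ws where "ys = vs @ ws" and vs: "length vs = n"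
    by (rule split_list_length[of n ys]) (use assms us in linarith)
  ultimately have xs: "xs = us @ vs @ ws" by simp
  obtain d where t: "t = i + n + d" using assms(1) le_iff_add by blast
  have "xs[t := x] = us @ vs @ ws[d := x]"
    using us vs by (simp add: xs t list_update_append)
  then show ?thesis
    using us vs by (simp add: xs t plug_append list_update_append)
qed

text \<open>The two blocks are disjoint, that of \<open>h\<close> on the left. Plugging
  \<open>h\<close> first shortens the list by \<open>r\<close>, so slot \<open>b\<close> of the
  shortened list is slot \<open>b + r\<close> of the original.\<close>

lemma plug_commute:
  assumes "a < b" "b + q + r + 1 \<le> length xs"
  shows "plug b (Suc q) g (plug a (Suc r) h xs) = plug a (Suc r) h (plug (b + r) (Suc q) g xs)"
proof -
  \<comment> \<open>The list is cut into five segments: the entries before \<open>a\<close>, the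
    block of \<open>h\<close>, the gap, the block of \<open>g\<close>, and the rest. Then
    \<open>plug_append\<close> evaluates each insertion.\<close>
  obtain us ys where 1: "xs = us @ ys" "length us = a" "length xs = a + length ys"
    by (rule split_list_length[of a xs]) (use assms in linarith)
  obtain vs zs where 2: "ys = vs @ zs" "length vs = Suc r" "length ys = Suc r + length zs"
    by (rule split_list_length[of "Suc r" ys]) (use assms 1(2-) in linarith)
  obtain ws ts where 3: "zs = ws @ ts" "length ws = b - Suc a" "length zs = (b - Suc a) + length ts"
    by (rule split_list_length[of "b - Suc a" zs]) (use assms 1(2-) 2(2-) in linarith)
  obtain cs ds where 4: "ts = cs @ ds" "length cs = Suc q"
    by (rule split_list_length[of "Suc q" ts]) (use assms 1(2-) 2(2-) 3(2-) in linarith)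
  have xs: "xs = us @ vs @ ws @ cs @ ds" by (simp add: 1 2 3 4)
  have len: "length (us @ h vs # ws) = b" "length (us @ vs @ ws) = b + r"
    using assms 1(2-) 2(2-) 3(2-) by auto
  have "plug a (Suc r) h xs = us @ h vs # ws @ cs @ ds"
    unfolding xs by (rule plug_append[OF 1(2) 2(2)])
  moreover have "plug b (Suc q) g ((us @ h vs # ws) @ cs @ ds) = (us @ h vs # ws) @ g cs # ds"
    by (rule plug_append[OF len(1) 4(2)])
  moreover have "plug (b + r) (Suc q) g ((us @ vs @ ws) @ cs @ ds) = (us @ vs @ ws) @ g cs # ds"
    by (rule plug_append[OF len(2) 4(2)])
  moreover have "plug a (Suc r) h (us @ vs @ ws @ g cs # ds) = us @ h vs # ws @ g cs # ds"
    by (rule plug_append[OF 1(2) 2(2)])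
  ultimately show ?thesis by (simp add: xs)
qed

text \<open>For \<open>l \<le> q\<close> the value of \<open>h\<close> becomes argument
  \<open>l\<close> of \<open>g\<close>, so \<open>g\<close> and \<open>h\<close> together consume
  one block of \<open>q + r + 1\<close> original entries.\<close>

lemma plug_nested:
  assumes "i + q + r + 1 \<le> length xs" "l \<le> q"
  shows "plug i (Suc q) g (plug (i + l) (Suc r) h xs) =
    plug i (Suc (q + r)) (\<lambda>ys. g (plug l (Suc r) h ys)) xs"
proof -
  obtain us ys where 1: "xs = us @ ys" "length us = i" "length xs = i + length ys"
    by (rule split_list_length[of i xs]) (use assms in linarith)
  obtain vs zs where 2: "ys = vs @ zs" "length vs = l" "length ys = l + length zs"
    by (rule split_list_length[of l ys]) (use assms 1(2-) in linarith)
  obtain ws ts where 3: "zs = ws @ ts" "length ws = Suc r" "length zs = Suc r + length ts"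
    by (rule split_list_length[of "Suc r" zs]) (use assms 1(2-) 2(2-) in linarith)
  obtain cs ds where 4: "ts = cs @ ds" "length cs = q - l"
    by (rule split_list_length[of "q - l" ts]) (use assms 1(2-) 2(2-) 3(2-) in linarith)
  have xs: "xs = us @ (vs @ ws @ cs) @ ds" by (simp add: 1 2 3 4)
  have len: "length (us @ vs) = i + l" "length (vs @ h ws # cs) = Suc q"
      "length (vs @ ws @ cs) = Suc (q + r)"
    using assms 1(2-) 2(2-) 3(2-) 4(2) by auto
  have "plug (i + l) (Suc r) h ((us @ vs) @ ws @ cs @ ds) = (us @ vs) @ h ws # cs @ ds"
    by (rule plug_append[OF len(1) 3(2)])
  moreover have "plug i (Suc q) g (us @ (vs @ h ws # cs) @ ds) = us @ g (vs @ h ws # cs) # ds"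
    by (rule plug_append[OF 1(2) len(2)])
  moreover have "plug i (Suc (q + r)) (\<lambda>ys. g (plug l (Suc r) h ys)) xs =
      us @ g (plug l (Suc r) h (vs @ ws @ cs)) # ds"
    unfolding xs by (rule plug_append[OF 1(2) len(3)])
  moreover have "plug l (Suc r) h (vs @ ws @ cs) = vs @ h ws # cs"
    by (rule plug_append[OF 2(2) 3(2)])
  ultimately show ?thesis by (simp add: xs)
qed

text \<open>With \<open>g\<close> of arity \<open>q + 1\<close> already in slot \<open>i\<close> of
  \<open>f\<close>, a further function goes to the left of \<open>g\<close>, into \<open>g\<close>,
  or to its right. On the right, slot \<open>b\<close> of \<open>f\<close> has become slot
  \<open>b + q\<close>.\<close>

lemma sum_lessThan_split_insertion:
  fixes t :: "nat \<Rightarrow> 'b::comm_monoid_add"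
  assumes "i < m"
  shows "(\<Sum>j<m + q. t j) =
    (\<Sum>j<i. t j) + (\<Sum>l<Suc q. t (i + l)) + (\<Sum>b\<in>{Suc i..<m}. t (b + q))"
proof -
  have "(\<Sum>j<m + q. t j) = (\<Sum>j\<in>{0..<i}. t j) + (\<Sum>j\<in>{i..<m + q}. t j)"
    using assms by (simp add: sum.atLeastLessThan_concat lessThan_atLeast0)
  also have "(\<Sum>j\<in>{i..<m + q}. t j) =
      (\<Sum>j\<in>{i..<i + Suc q}. t j) + (\<Sum>j\<in>{i + Suc q..<m + q}. t j)"
    using assms by (subst sum.atLeastLessThan_concat) auto
  also have "(\<Sum>j\<in>{i..<i + Suc q}. t j) = (\<Sum>l<Suc q. t (i + l))"
    using sum.shift_bounds_nat_ivl[of t 0 i "Suc q"]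
    by (simp add: lessThan_atLeast0 add.commute del: sum.op_ivl_Suc)
  also have "(\<Sum>j\<in>{i + Suc q..<m + q}. t j) = (\<Sum>b\<in>{Suc i..<m}. t (b + q))"
    using sum.shift_bounds_nat_ivl[of t "Suc i" q m] by simp
  finally show ?thesis by (simp add: lessThan_atLeast0 add.assoc)
qed

lemma sum_triangle_swap:
  fixes u :: "nat \<Rightarrow> nat \<Rightarrow> 'b::comm_monoid_add"
  shows "(\<Sum>i<m. \<Sum>b\<in>{Suc i..<m}. u i b) = (\<Sum>b<m. \<Sum>i<b. u i b)"
proof -
  have "(\<Sum>i<m. \<Sum>b\<in>{Suc i..<m}. u i b) = (\<Sum>i<m. \<Sum>b\<in>{b. b \<in> {..<m} \<and> i < b}. u i b)"
    by (intro sum.cong) auto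
  also have "\<dots> = (\<Sum>b<m. \<Sum>i\<in>{i. i \<in> {..<m} \<and> i < b}. u i b)"
    by (rule sum.swap_restrict) auto
  also have "\<dots> = (\<Sum>b<m. \<Sum>i<b. u i b)"
    by (intro sum.cong) auto
  finally show ?thesis .
qed

section \<open>Multilinear cochains and closure under insertion\<close>

text \<open>The purpose is to fix the scalars to sort \<open>field_char_0\<close>, which the
  constants for cochains and brackets demand.\<close>

locale vector_space_char_0 = vector_space s
  for s :: "'k::field_char_0 \<Rightarrow> 'a::ab_group_add \<Rightarrow> 'a"
begin

lemma linear_endo_iff:
  "Vector_Spaces.linear s s \<phi> \<longleftrightarrow>
    (\<forall>x y. \<phi> (x + y) = \<phi> x + \<phi> y) \<and> (\<forall>c x. \<phi> (s c x) = s c (\<phi> x))"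
  using vector_space_axioms by (simp add: Vector_Spaces.linear_iff)

lemma linear_endo_compose:
  "Vector_Spaces.linear s s \<phi> \<Longrightarrow> Vector_Spaces.linear s s \<psi> \<Longrightarrow>
    Vector_Spaces.linear s s (\<lambda>x. \<phi> (\<psi> x))"
  by (simp add: linear_endo_iff)

lemma linear_endo_scale: "Vector_Spaces.linear s s \<phi> \<Longrightarrow> Vector_Spaces.linear s s (\<lambda>x. s c (\<phi> x))"
  by (simp add: linear_endo_iff scale_right_distrib mult.commute)

lemma linear_endo_sum:
  "(\<And>i. i \<in> I \<Longrightarrow> Vector_Spaces.linear s s (\<phi> i)) \<Longrightarrow> Vector_Spaces.linear s s (\<lambda>x. \<Sum>i\<in>I. \<phi> i x)"
  by (simp add: linear_endo_iff sum.distrib scale_sum_right)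

lemma cochains_linear:
  "f \<in> cochains s n \<Longrightarrow> length xs = n \<Longrightarrow> i < n \<Longrightarrow> Vector_Spaces.linear s s (\<lambda>x. f (xs[i := x]))"
  by (simp add: cochains_def)

lemma cochains_linear_append:
  assumes "f \<in> cochains s n" "length us + length ws + 1 = n"
  shows "Vector_Spaces.linear s s (\<lambda>x. f (us @ x # ws))"
  using cochains_linear[of f n "us @ 0 # ws" "length us"] assms by simp

text \<open>Insertion uses the inner function only through its value on one block, so a constant
  function exposes the slot. Linearity there makes insertion into \<open>f\<close> linear in the
  inserted function, as the next lemmas record.\<close>

lemma cochains_linear_plug:
  assumes "f \<in> cochains s m" "i < m" "length xs + 1 = m + n"
  shows "Vector_Spaces.linear s s (\<lambda>x. f (plug i n (\<lambda>ys. x) xs))"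
  unfolding plug_def using assms(2,3) by (intro cochains_linear_append[OF assms(1)]) auto

lemma plug_add:
  assumes "f \<in> cochains s m" "i < m" "length xs + 1 = m + n"
  shows "f (plug i n (\<lambda>ys. g ys + h ys) xs) = f (plug i n g xs) + f (plug i n h xs)"
  using cochains_linear_plug[OF assms] by (simp add: linear_endo_iff plug_def)

lemma plug_scale:
  assumes "f \<in> cochains s m" "i < m" "length xs + 1 = m + n"
  shows "f (plug i n (\<lambda>ys. s c (g ys)) xs) = s c (f (plug i n g xs))"
  using cochains_linear_plug[OF assms] by (simp add: linear_endo_iff plug_def)

lemma plug_zero:
  assumes "f \<in> cochains s m" "i < m" "length xs + 1 = m + n"
  shows "f (plug i n (\<lambda>ys. 0) xs) = 0"
  using plug_scale[OF assms, of 0 "\<lambda>ys. 0"] by simp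

lemma plug_sum:
  assumes "f \<in> cochains s m" "i < m" "length xs + 1 = m + n"
  shows "f (plug i n (\<lambda>ys. \<Sum>l\<in>I. g l ys) xs) = (\<Sum>l\<in>I. f (plug i n (g l) xs))"
  by (induction I rule: infinite_finite_induct)
    (simp_all add: plug_zero[OF assms] plug_add[OF assms])

lemma cochains_closed_add: "f \<in> cochains s n \<Longrightarrow> g \<in> cochains s n \<Longrightarrow> f + g \<in> cochains s n"
  by (simp add: cochains_def linear_endo_iff scale_right_distrib)

lemma cochains_closed_scale: "f \<in> cochains s n \<Longrightarrow> (\<lambda>xs. s c (f xs)) \<in> cochains s n"
  by (simp add: cochains_def linear_endo_scale)

lemma zero_in_cochains: "0 \<in> cochains s n"
  by (simp add: cochains_def linear_endo_iff)

text \<open>An entry outside the block of \<open>g\<close> remains an argument of \<open>f\<close>,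
  possibly shifted. An entry inside the block acts through a slot of \<open>g\<close> followed by
  slot \<open>i\<close> of \<open>f\<close>, a composition of linear maps.\<close>

lemma gcirc_closed:
  assumes f: "f \<in> cochains s m" and g: "g \<in> cochains s (Suc q)"
  shows "gcirc s m (Suc q) f g \<in> cochains s (m + q)"
proof -
  have "Vector_Spaces.linear s s (\<lambda>x. f (plug i (Suc q) g (xs[t := x])))"
    if xs: "length xs = m + q" and t: "t < m + q" and i: "i < m" for xs t i
  proof -
    have len: "length (plug i (Suc q) g xs) = m"
      using xs i by (simp add: length_plug)
    consider "t < i" | "i \<le> t" "t < i + Suc q" | "i + Suc q \<le> t" by linarith
    then show ?thesis
    proof cases
      case 1
      then show ?thesis
        using cochains_linear[OF f len, of t] xs i by (simp add: plug_list_update_before)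
    next
      case 2
      have "Vector_Spaces.linear s s (\<lambda>x. g ((take (Suc q) (drop i xs))[t - i := x]))"
        using 2 xs i by (intro cochains_linear[OF g]) auto
      moreover have "Vector_Spaces.linear s s (\<lambda>x. f (take i xs @ x # drop (i + Suc q) xs))"
        using xs i by (intro cochains_linear_append[OF f]) auto
      ultimately show ?thesis
        using 2 linear_endo_compose by (simp add: plug_list_update_inside)
    next
      case 3
      then show ?thesis
        using cochains_linear[OF f len, of "t + 1 - Suc q"] xs i t
        by (simp add: plug_list_update_after)
    qed
  qed
  then show ?thesis
    by (auto simp: cochains_def gcirc_plug intro!: linear_endo_sum linear_endo_scale)
qed

section \<open>The pre-Lie identity for insertion\<close>

text \<open>Up to sign, the brace operation f{h, g}: \<open>h\<close> stands to the left of
  \<open>g\<close>. Both \<open>a\<close> and \<open>b\<close> are slots of \<open>f\<close> itself,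
  while \<open>q\<close> and \<open>r\<close> are the degrees of \<open>g\<close> and
  \<open>h\<close>, one less than their arities.\<close>

definition disjoint_insertions ::
  "nat \<Rightarrow> nat \<Rightarrow> nat \<Rightarrow> ('a list \<Rightarrow> 'a) \<Rightarrow> ('a list \<Rightarrow> 'a) \<Rightarrow> ('a list \<Rightarrow> 'a) \<Rightarrow> 'a list \<Rightarrow> 'a"
  where "disjoint_insertions m q r f g h xs =
    (\<Sum>b<m. \<Sum>a<b. s ((- 1) ^ (a * r + b * q)) (f (plug b (Suc q) g (plug a (Suc r) h xs))))"

text \<open>The insertions of \<open>h\<close> into \<open>g\<close> make up f o (g o h), since
  multilinearity of \<open>f\<close> pulls out the sum that defines g o h. What survives has
  \<open>h\<close> to the left or to the right of \<open>g\<close>; exchanging \<open>g\<close> with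
  \<open>h\<close> and \<open>q\<close> with \<open>r\<close> reproduces it up to the sign
  (-1)^(qr).\<close>

lemma gcirc_associator:
  assumes f: "f \<in> cochains s m" and xs: "length xs = m + q + r"
  shows "gcirc s (m + q) (Suc r) (gcirc s m (Suc q) f g) h xs
      - gcirc s m (Suc (q + r)) f (gcirc s (Suc q) (Suc r) g h) xs =
    disjoint_insertions m q r f g h xs
      + s ((- 1) ^ (q * r)) (disjoint_insertions m r q f h g xs)"
proof -
  \<comment> \<open>Here \<open>i\<close> is the slot of \<open>g\<close> in \<open>f\<close>, and
    \<open>j\<close> is the slot of \<open>h\<close> in the composite of \<open>f\<close> and
    \<open>g\<close>.\<close>
  define t where "t i j = s ((- 1) ^ (j * r + i * q)) (f (plug i (Suc q) g (plug j (Suc r) h xs)))"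
    for i j
  have "gcirc s (m + q) (Suc r) (gcirc s m (Suc q) f g) h xs = (\<Sum>j<m + q. \<Sum>i<m. t i j)"
    using xs by (simp add: gcirc_plug length_plug t_def scale_sum_right power_add)
  also have "\<dots> = (\<Sum>i<m. \<Sum>j<m + q. t i j)"
    by (rule sum.swap)
  also have "\<dots> = (\<Sum>i<m. \<Sum>j<i. t i j) + (\<Sum>i<m. \<Sum>l<Suc q. t i (i + l))
      + (\<Sum>i<m. \<Sum>b\<in>{Suc i..<m}. t i (b + q))"
    by (simp add: sum_lessThan_split_insertion sum.distrib del: sum.lessThan_Suc)
  also have "(\<Sum>i<m. \<Sum>j<i. t i j) = disjoint_insertions m q r f g h xs"
    by (simp add: t_def disjoint_insertions_def)
  also have "(\<Sum>i<m. \<Sum>b\<in>{Suc i..<m}. t i (b + q)) =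
      s ((- 1) ^ (q * r)) (disjoint_insertions m r q f h g xs)"
  proof -
    \<comment> \<open>Passing to slots of \<open>f\<close> lowers the exponent
      \<open>(b + q) * r\<close> to \<open>b * r\<close>; the difference \<open>q * r\<close> is the
      Koszul sign for exchanging \<open>g\<close> and \<open>h\<close>.\<close>
    have "t i (b + q) = s ((- 1) ^ (q * r))
        (s ((- 1) ^ (i * q + b * r)) (f (plug b (Suc r) h (plug i (Suc q) g xs))))"
      if "b < m" "i < b" for i b
      using that xs by (simp add: t_def plug_commute power_add[symmetric] algebra_simps)
    then show ?thesis
      by (simp add: sum_triangle_swap disjoint_insertions_def scale_sum_right)
  qed
  also have "(\<Sum>i<m. \<Sum>l<Suc q. t i (i + l)) =
      gcirc s m (Suc (q + r)) f (gcirc s (Suc q) (Suc r) g h) xs"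
  proof -
    have "s ((- 1) ^ (i * (q + r))) (f (plug i (Suc (q + r)) (gcirc s (Suc q) (Suc r) g h) xs)) =
        (\<Sum>l<Suc q. t i (i + l))" if i: "i < m" for i
    proof -
      have slot: "i < m" "length xs + 1 = m + Suc (q + r)" using i xs by auto
      have "f (plug i (Suc (q + r)) (gcirc s (Suc q) (Suc r) g h) xs) =
          f (plug i (Suc (q + r)) (\<lambda>ys. \<Sum>l<Suc q. s ((- 1) ^ (l * r)) (g (plug l (Suc r) h ys))) xs)"
        using i xs by (simp add: plug_def[of i] gcirc_plug del: sum.lessThan_Suc)
      also have "\<dots> = (\<Sum>l<Suc q. s ((- 1) ^ (l * r))
          (f (plug i (Suc (q + r)) (\<lambda>ys. g (plug l (Suc r) h ys)) xs)))"
        by (simp only: plug_sum[OF f slot] plug_scale[OF f slot])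
      also have "\<dots> = (\<Sum>l<Suc q. s ((- 1) ^ (l * r))
          (f (plug i (Suc q) g (plug (i + l) (Suc r) h xs))))"
        using i xs by (intro sum.cong refl) (simp add: plug_nested)
      finally show ?thesis
        by (simp add: t_def scale_sum_right power_add[symmetric] algebra_simps del: sum.lessThan_Suc)
    qed
    then show ?thesis
      using xs by (simp add: gcirc_plug)
  qed
  finally show ?thesis by (simp add: algebra_simps)
qed

text \<open>Degree -1 is set to zero although arity 0 would give a copy of A. This matches the
  AssDer complex and keeps the truncated arity \<open>n - 1\<close> away from nonzero cochains of
  arity 0.\<close>

definition cochain_component :: "int \<Rightarrow> ('a list \<Rightarrow> 'a) set"
  where "cochain_component i = (if i < 0 then {0} else cochains s (nat (i + 1)))"

lemma gcirc_zero_left: "gcirc s m n 0 g = 0"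
  by (auto simp: gcirc_def fun_eq_iff)

lemma gcirc_zero_right: "f \<in> cochains s m \<Longrightarrow> gcirc s m n f 0 = 0"
  by (auto simp: gcirc_plug fun_eq_iff zero_fun_def plug_zero intro!: sum.neutral)

lemma gcirc_component_zero_right: "f \<in> cochain_component i \<Longrightarrow> gcirc s (nat (i + 1)) n f 0 = 0"
  by (auto simp: cochain_component_def gcirc_zero_left gcirc_zero_right split: if_splits)

lemma zero_in_component: "0 \<in> cochain_component i"
  by (simp add: cochain_component_def zero_in_cochains)

lemma gcirc_component_closed:
  assumes "f \<in> cochain_component i" "g \<in> cochain_component j"
  shows "gcirc s (nat (i + 1)) (nat (j + 1)) f g \<in> cochain_component (i + j)"
proof (cases "i < 0 \<or> j < 0")
  \<comment> \<open>A factor of negative degree is 0, and 0 lies in every component, whatever the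
    total degree.\<close>
  case True
  then have "f = 0 \<or> g = 0"
    using assms by (auto simp: cochain_component_def)
  then show ?thesis
    using assms(1) by (auto simp: gcirc_zero_left gcirc_component_zero_right zero_in_component)
next
  case False
  then obtain p q where "i = int p" "j = int q"
    by (metis nonneg_int_cases not_less)
  then show ?thesis
    using assms gcirc_closed[of f "Suc p" g q] by (simp add: cochain_component_def nat_add_distrib)
qed

lemma gcirc_graded_pre_lie:
  "graded_pre_lie_algebra (\<lambda>c f xs. s c (f xs)) cochain_component
    (\<lambda>i j. gcirc s (nat (i + 1)) (nat (j + 1)))"
proof -
  interpret F: vector_space "\<lambda>c (f :: 'a list \<Rightarrow> 'a) xs. s c (f xs)"
    by unfold_locales (simp_all add: fun_eq_iff algebra_simps)
  let ?circ = "\<lambda>i j. gcirc s (nat (i + 1)) (nat (j + 1))"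
  show ?thesis
  proof
    fix i j k :: int and f f' g g' h :: "'a list \<Rightarrow> 'a" and c :: 'k
    show "F.subspace (cochain_component i)"
      by (auto simp: F.subspace_def cochain_component_def zero_in_cochains cochains_closed_add
          cochains_closed_scale)
    show "?circ i j f g \<in> cochain_component (i + j)"
      if "f \<in> cochain_component i" "g \<in> cochain_component j"
      using that by (rule gcirc_component_closed)
    show "?circ i j (f + f') g = ?circ i j f g + ?circ i j f' g"
      by (auto simp: fun_eq_iff gcirc_def scale_right_distrib sum.distrib)
    show "?circ i j (\<lambda>xs. s c (f xs)) g = (\<lambda>xs. s c (?circ i j f g xs))"
      by (auto simp: fun_eq_iff gcirc_def scale_sum_right mult.commute)
    show "?circ i j f (g + g') = ?circ i j f g + ?circ i j f g'" if "f \<in> cochain_component i"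
    proof (cases "i < 0")
      case True
      then show ?thesis using that by (simp add: cochain_component_def gcirc_zero_left)
    next
      case False
      then have "f \<in> cochains s (nat (i + 1))" using that by (simp add: cochain_component_def)
      then show ?thesis
        by (auto simp: fun_eq_iff gcirc_plug plus_fun_def plug_add scale_right_distrib sum.distrib)
    qed
    show "?circ i j f (\<lambda>xs. s c (g xs)) = (\<lambda>xs. s c (?circ i j f g xs))" if "f \<in> cochain_component i"
    proof (cases "i < 0")
      case True
      then show ?thesis using that by (auto simp: cochain_component_def gcirc_zero_left)
    next
      case False
      then have "f \<in> cochains s (nat (i + 1))" using that by (simp add: cochain_component_def)
      then show ?thesis
        by (auto simp: fun_eq_iff gcirc_plug plug_scale scale_sum_right mult.commute)
    qed
    show "?circ (i + j) k (?circ i j f g) h - ?circ i (j + k) f (?circ j k g h) =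
        (\<lambda>xs. s ((- 1) powi (j * k))
          ((?circ (i + k) j (?circ i k f h) g - ?circ i (k + j) f (?circ k j h g)) xs))"
      if f: "f \<in> cochain_component i" and g: "g \<in> cochain_component j" and h: "h \<in> cochain_component k"
    proof (cases "i < 0 \<or> j < 0 \<or> k < 0")
      case True
      then have "f = 0 \<or> g = 0 \<or> h = 0"
        using f g h by (auto simp: cochain_component_def)
      then have zero: "?circ (i + j) k (?circ i j f g) h = 0" "?circ i (j + k) f (?circ j k g h) = 0"
          "?circ (i + k) j (?circ i k f h) g = 0" "?circ i (k + j) f (?circ k j h g) = 0"
        using f g h gcirc_component_closed[OF f g] gcirc_component_closed[OF f h]
        by (auto simp: gcirc_zero_left gcirc_component_zero_right)
      show ?thesis
        unfolding zero by (simp add: fun_eq_iff)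
    next
      case False
      then obtain p q r where ijk: "i = int p" "j = int q" "k = int r"
        by (metis nonneg_int_cases not_less)
      have f: "f \<in> cochains s (Suc p)"
        using f by (simp add: cochain_component_def ijk nat_add_distrib)
      show ?thesis
      proof
        fix xs :: "'a list"
        show "(?circ (i + j) k (?circ i j f g) h - ?circ i (j + k) f (?circ j k g h)) xs =
          s ((- 1) powi (j * k))
            ((?circ (i + k) j (?circ i k f h) g - ?circ i (k + j) f (?circ k j h g)) xs)"
        proof (cases "length xs = Suc p + q + r")
          case True
          \<comment> \<open>The two instances of \<open>gcirc_associator\<close>, for
            \<open>g\<close>, \<open>h\<close> and for \<open>h\<close>, \<open>g\<close>, have
            right-hand sides that differ by the factor (-1)^(qr).\<close>
          then show ?thesis
            using gcirc_associator[OF f True, of g h] gcirc_associator[OF f, of xs r q h g]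
            by (cases "even q"; cases "even r")
              (simp_all add: ijk nat_add_distrib ac_simps power_int_minus_one_eq minus_one_power_iff)
        next
          case False
          then show ?thesis by (auto simp: gcirc_def ijk nat_add_distrib)
        qed
      qed
    qed
  qed
qed


section \<open>The graded Lie algebra of AssDer cochains\<close>

theorem assder_graded_lie_algebra:
  "graded_lie_algebra (cochain_pair_scale s) (assder_component s) (assder_degree_bracket s)"
proof -
  interpret pre_lie: graded_pre_lie_algebra "\<lambda>c (f :: 'a list \<Rightarrow> 'a) xs. s c (f xs)" cochain_component
    "\<lambda>i j. gcirc s (nat (i + 1)) (nat (j + 1))"
    by (rule gcirc_graded_pre_lie)
  define br where "br i j f g = gcirc s (nat (i + 1)) (nat (j + 1)) f g -
    (\<lambda>xs. s ((- 1) powi (i * j)) (gcirc s (nat (j + 1)) (nat (i + 1)) g f xs))" for i j f g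
  have br: "graded_lie_algebra (\<lambda>c f xs. s c (f xs)) cochain_component br"
    using pre_lie.graded_lie_algebra_commutator unfolding br_def .
  have gerstenhaber: "gerstenhaber s (nat (i + 1)) (nat (j + 1)) f g = br i j f g"
    if f: "f \<in> cochain_component i" and g: "g \<in> cochain_component j" for i j f g
  proof (cases "i < 0 \<or> j < 0")
    case True
    then have "f = 0 \<or> g = 0"
      using f g by (auto simp: cochain_component_def)
    then show ?thesis
      using f g by (auto simp: gerstenhaber_def br_def gcirc_zero_left gcirc_component_zero_right)
  next
    case False
    then obtain p q where "i = int p" "j = int q"
      by (metis nonneg_int_cases not_less)
    then show ?thesis
      by (auto simp: gerstenhaber_def br_def power_int_minus_one_eq nat_add_distrib fun_eq_iff)
  qed
  have scale: "(\<lambda>c (f, f'). (\<lambda>xs. s c (f xs), \<lambda>xs. s c (f' xs))) = cochain_pair_scale s"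
    by (auto simp: fun_eq_iff)
  \<comment> \<open>The zero component in degree -1 is what makes the second factor vanish in degree
    0, leaving Hom(A, A) paired with 0.\<close>
  have component: "(\<lambda>i. cochain_component i \<times> cochain_component (i - 1)) = assder_component s"
    by (auto simp: fun_eq_iff assder_component_def assder_cochains_def cochain_component_def
        zero_prod_def nat_diff_distrib nat_add_distrib)
  show ?thesis
  proof (rule graded_lie_algebra_cong[OF graded_lie_algebra_pair[OF br, unfolded scale component]])
    fix i j x y
    assume "x \<in> assder_component s i" "y \<in> assder_component s j"
    then obtain f f' g g' where xy: "x = (f, f')" "y = (g, g')"
      and mem: "f \<in> cochain_component i" "f' \<in> cochain_component (i - 1)"
        "g \<in> cochain_component j" "g' \<in> cochain_component (j - 1)"
      unfolding component[symmetric] by blast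
    \<comment> \<open>Both sides truncate alike, so lowering the arity agrees with lowering the
      degree for negative \<open>l\<close> too.\<close>
    have arity: "nat (l + 1) - 1 = nat (l - 1 + 1)" for l
      by simp
    have left: "gerstenhaber s (nat (i + 1) - 1) (nat (j + 1)) f' g = br (i - 1) j f' g"
      using gerstenhaber[OF mem(2,3)] unfolding arity .
    have right: "gerstenhaber s (nat (i + 1)) (nat (j + 1) - 1) f g' = br i (j - 1) f g'"
      using gerstenhaber[OF mem(1,4)] unfolding arity .
    \<comment> \<open>For \<open>i \<ge> 0\<close> the exponent is \<open>i + 2\<close>. For
      negative \<open>i\<close> truncation can spoil the parity, but then
      \<open>f = 0\<close>.\<close>
    have sign: "s ((- 1) ^ (nat (i + 1) + 1)) (br i (j - 1) f g' xs) =
        s ((- 1) powi i) (br i (j - 1) f g' xs)" for xs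
    proof (cases "i < 0")
      case True
      then have "f = 0" using mem(1) by (simp add: cochain_component_def)
      then show ?thesis
        using gcirc_component_zero_right[OF mem(4)] by (simp add: br_def gcirc_zero_left)
    next
      case False
      then show ?thesis
        by (simp add: power_int_minus_one_eq even_nat_iff nat_add_distrib minus_one_power_iff)
    qed
    show "assder_degree_bracket s i j x y = (case x of (x, x') \<Rightarrow> \<lambda>(y, y').
        (br i j x y, (\<lambda>xs. s ((- 1) powi i) (br i (j - 1) x y' xs)) + br (i - 1) j x' y)) y"
      by (simp add: xy assder_degree_bracket_def gerstenhaber[OF mem(1,3)] left right sign
          plus_fun_def del: power_Suc One_nat_def add_Suc_right)
  qed
qed

section \<open>Maurer-Cartan elements for zero differentials\<close>

lemma bidiff_graded_lie_algebra_zero: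
  assumes "graded_lie_algebra s' L br"
  shows "bidiff_graded_lie_algebra s' L br (\<lambda>i x. 0) (\<lambda>i x. 0)"
proof -
  interpret L: graded_lie_algebra s' L br by fact
  have zero: "0 \<in> L i" for i
    by (rule L.subspace_0[OF L.subspace_L])
  have "br i j 0 y = 0" if "y \<in> L j" for i j y
    using L.br_scale_left[OF zero that, of i 0] by simp
  moreover have "br i j x 0 = 0" if "x \<in> L i" for i j x
    using L.br_scale_right[OF that zero, of j 0] by simp
  ultimately show ?thesis
    by unfold_locales (auto simp: zero)
qed

lemma cochain1_in_cochains: "Vector_Spaces.linear s s \<delta> \<Longrightarrow> cochain1 \<delta> \<in> cochains s 1"
  by (auto simp: cochains_def cochain1_def)

lemma cochain2_in_cochains:
  assumes "bilinear_op s w"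
  shows "cochain2 w \<in> cochains s 2"
proof -
  have "Vector_Spaces.linear s s (\<lambda>x. cochain2 w (xs[i := x]))" if "length xs = 2" "i < 2" for xs i
    using that assms by (cases "i = 0") (auto simp: cochain2_def bilinear_op_def less_2_cases_iff)
  then show ?thesis by (auto simp: cochains_def cochain2_def)
qed

lemma cochain_pair_in_component:
  "bilinear_op s w \<Longrightarrow> Vector_Spaces.linear s s \<delta> \<Longrightarrow> (cochain2 w, cochain1 \<delta>) \<in> assder_component s 1"
  by (simp add: assder_component_def assder_cochains_def cochain1_in_cochains[simplified]
      cochain2_in_cochains)

text \<open>Both arguments have odd degree, so the graded commutator is a sum and the two mixed
  associators add up.\<close>

lemma gerstenhaber_2_2: "gerstenhaber s 2 2 (cochain2 w) (cochain2 v) [x, y, z] =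
    w (v x y) z - w x (v y z) + (v (w x y) z - v x (w y z))"
  by (simp add: gerstenhaber_def gcirc_def cochain2_def numeral_2_eq_2)

lemma gerstenhaber_2_1:
  "gerstenhaber s 2 1 (cochain2 w) (cochain1 \<delta>) [x, y] = w (\<delta> x) y + w x (\<delta> y) - \<delta> (w x y)"
  by (simp add: gerstenhaber_def gcirc_def cochain2_def cochain1_def numeral_2_eq_2)

lemma gerstenhaber_1_2:
  "gerstenhaber s 1 2 (cochain1 \<delta>) (cochain2 w) [x, y] = \<delta> (w x y) - (w (\<delta> x) y + w x (\<delta> y))"
  by (simp add: gerstenhaber_def gcirc_def cochain2_def cochain1_def numeral_2_eq_2)

lemma fun_eq_0_length_2:
  fixes F :: "'a list \<Rightarrow> 'b::zero"
  assumes "\<And>xs. length xs \<noteq> 2 \<Longrightarrow> F xs = 0"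
  shows "F = 0 \<longleftrightarrow> (\<forall>x y. F [x, y] = 0)"
proof (intro iffI ext allI)
  fix xs assume *: "\<forall>x y. F [x, y] = 0"
  show "F xs = 0 xs"
    using assms * by (cases "length xs = 2") (auto simp: length_Suc_conv numeral_2_eq_2)
qed simp

lemma fun_eq_0_length_3:
  fixes F :: "'a list \<Rightarrow> 'b::zero"
  assumes "\<And>xs. length xs \<noteq> 3 \<Longrightarrow> F xs = 0"
  shows "F = 0 \<longleftrightarrow> (\<forall>x y z. F [x, y, z] = 0)"
proof (intro iffI ext allI)
  fix xs assume *: "\<forall>x y z. F [x, y, z] = 0"
  show "F xs = 0 xs"
    using assms * by (cases "length xs = 3") (auto simp: length_Suc_conv numeral_3_eq_3)
qed simp

text \<open>Two independent pairs are allowed so that the diagonal case serves the Maurer-Cartan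
  equations and the mixed case serves compatibility.\<close>

lemma assder_bracket_eq_0_iff:
  "assder_degree_bracket s 1 1 (cochain2 w, cochain1 \<delta>) (cochain2 v, cochain1 \<eta>) = 0 \<longleftrightarrow>
    (\<forall>x y z. w (v x y) z + v (w x y) z = w x (v y z) + v x (w y z)) \<and>
    (\<forall>x y. \<delta> (v x y) + \<eta> (w x y) = v (\<delta> x) y + v x (\<delta> y) + w (\<eta> x) y + w x (\<eta> y))"
proof -
  have "gerstenhaber s 2 2 (cochain2 w) (cochain2 v) = 0 \<longleftrightarrow>
      (\<forall>x y z. w (v x y) z + v (w x y) z = w x (v y z) + v x (w y z))"
    by (subst fun_eq_0_length_3)
      (auto simp: gerstenhaber_2_2 algebra_simps, auto simp: gerstenhaber_def gcirc_def)
  \<comment> \<open>The sign (-1)^3 reverses the bracket of \<open>w\<close> with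
    \<open>\<eta>\<close>, so the failures of \<open>\<eta>\<close> to derive \<open>w\<close> and
    of \<open>\<delta>\<close> to derive \<open>v\<close> are added.\<close>
  moreover have "(\<lambda>xs. s ((- 1) ^ (2 + 1)) (gerstenhaber s 2 1 (cochain2 w) (cochain1 \<eta>) xs) +
        gerstenhaber s 1 2 (cochain1 \<delta>) (cochain2 v) xs) = 0 \<longleftrightarrow>
      (\<forall>x y. \<delta> (v x y) + \<eta> (w x y) = v (\<delta> x) y + v x (\<delta> y) + w (\<eta> x) y + w x (\<eta> y))"
  proof (subst fun_eq_0_length_2)
    show "(\<forall>x y. s ((- 1) ^ (2 + 1)) (gerstenhaber s 2 1 (cochain2 w) (cochain1 \<eta>) [x, y]) +
        gerstenhaber s 1 2 (cochain1 \<delta>) (cochain2 v) [x, y] = 0) \<longleftrightarrow>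
      (\<forall>x y. \<delta> (v x y) + \<eta> (w x y) = v (\<delta> x) y + v x (\<delta> y) + w (\<eta> x) y + w x (\<eta> y))"
      unfolding gerstenhaber_2_1 gerstenhaber_1_2 by (simp add: algebra_simps)
  qed (simp add: gerstenhaber_def gcirc_def)
  ultimately show ?thesis
    by (simp add: assder_degree_bracket_def zero_prod_def)
qed

text \<open>On the diagonal, the bracket yields associativity and the Leibniz rule doubled; since 2
  is nonzero in characteristic 0, the factor cancels.\<close>

lemma double_eq_iff: "x + x = y + y \<longleftrightarrow> x = y" for x y :: 'a
proof -
  have "x + x = s 2 x" for x
    using scale_left_distrib[of 1 1 x] by simp
  then show ?thesis by simp
qed

lemma maurer_cartan_iff_assder_pair:
  assumes "bilinear_op s w" "Vector_Spaces.linear s s \<delta>"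
  shows "maurer_cartan (cochain_pair_scale s) (assder_component s) (assder_degree_bracket s)
    (\<lambda>i x. 0) (cochain2 w, cochain1 \<delta>) \<longleftrightarrow> assder_pair s w \<delta>"
proof -
  interpret L: bidiff_graded_lie_algebra "cochain_pair_scale s" "assder_component s"
    "assder_degree_bracket s" "\<lambda>i x. 0" "\<lambda>i x. 0"
    by (rule bidiff_graded_lie_algebra_zero[OF assder_graded_lie_algebra])
  have "maurer_cartan (cochain_pair_scale s) (assder_component s) (assder_degree_bracket s)
      (\<lambda>i x. 0) (cochain2 w, cochain1 \<delta>) \<longleftrightarrow>
    assder_degree_bracket s 1 1 (cochain2 w, cochain1 \<delta>) (cochain2 w, cochain1 \<delta>) = 0"
    using assms by (simp add: maurer_cartan_def L.diff_graded_lie_algebra_axioms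
        cochain_pair_in_component)
  also have "\<dots> \<longleftrightarrow> (\<forall>x y z. w (w x y) z + w (w x y) z = w x (w y z) + w x (w y z)) \<and>
      (\<forall>x y. \<delta> (w x y) + \<delta> (w x y) = (w (\<delta> x) y + w x (\<delta> y)) + (w (\<delta> x) y + w x (\<delta> y)))"
    by (simp add: assder_bracket_eq_0_iff add.assoc)
  also have "\<dots> \<longleftrightarrow> assder_pair s w \<delta>"
    unfolding double_eq_iff using assms vector_space_axioms by (simp add: assder_pair_def)
  finally show ?thesis .
qed

end

theorem theorem5p1:
  fixes s :: "'k::field_char_0 \<Rightarrow> 'a::ab_group_add \<Rightarrow> 'a"
    and w\<^sub>1 w\<^sub>2 :: "'a \<Rightarrow> 'a \<Rightarrow> 'a" and \<delta>\<^sub>1 \<delta>\<^sub>2 :: "'a \<Rightarrow> 'a"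
  assumes "vector_space s"
    and "bilinear_op s w\<^sub>1" and "bilinear_op s w\<^sub>2"
    and "Vector_Spaces.linear s s \<delta>\<^sub>1" and "Vector_Spaces.linear s s \<delta>\<^sub>2"
  shows "compatible_assder_pair s w\<^sub>1 w\<^sub>2 \<delta>\<^sub>1 \<delta>\<^sub>2 \<longleftrightarrow>
    compatible_maurer_cartan (cochain_pair_scale s) (assder_component s) (assder_degree_bracket s)
      (\<lambda>i x. 0) (\<lambda>i x. 0) (cochain2 w\<^sub>1, cochain1 \<delta>\<^sub>1) (cochain2 w\<^sub>2, cochain1 \<delta>\<^sub>2)"
proof -
  interpret vector_space_char_0 s
    by (rule vector_space_char_0.intro) fact
  have "compatible_maurer_cartan (cochain_pair_scale s) (assder_component s) (assder_degree_bracket s)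
      (\<lambda>i x. 0) (\<lambda>i x. 0) (cochain2 w\<^sub>1, cochain1 \<delta>\<^sub>1) (cochain2 w\<^sub>2, cochain1 \<delta>\<^sub>2) \<longleftrightarrow>
    assder_pair s w\<^sub>1 \<delta>\<^sub>1 \<and> assder_pair s w\<^sub>2 \<delta>\<^sub>2 \<and>
    assder_degree_bracket s 1 1 (cochain2 w\<^sub>1, cochain1 \<delta>\<^sub>1) (cochain2 w\<^sub>2, cochain1 \<delta>\<^sub>2) = 0"
    \<comment> \<open>The ambient structure always exists, so only the two Maurer-Cartan equations
      and the vanishing of the mixed bracket remain.\<close>
    using assms bidiff_graded_lie_algebra_zero[OF assder_graded_lie_algebra]
    by (simp add: compatible_maurer_cartan_def maurer_cartan_iff_assder_pair)
  then show ?thesis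
    by (simp add: compatible_assder_pair_def assder_bracket_eq_0_iff ac_simps)
qed

end
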